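(* Let $C$ be an abelian category and $I$ a small category. Given a sequence $L\xrightarrow{f}M\xrightarrow{g}N$ in $C^I$ such that $gf=0$, the following are equivalent: (a) the sequence is exact at $M$; (b) the canonical map $\operatorname{im}(f)\to\ker(g)$ is an isomorphism; (c) the canonical map $\operatorname{im}(f^i)\to\ker(g^i)$ is an isomorphism for all $i\in I$; (d) the sequence $L^i\xrightarrow{f^i}M^i\xrightarrow{g^i}N^i$ is exact at $M^i$ for all $i\in I$.
   Context: $C^I$ denotes the (abelian) category of functors $I\to C$ with natural transformations as morphisms. For $A\in C^I$, $A^i\in C$ is its value at $i\in I$, and for a morphism $f$ in $C^I$, $f^i$ is its component at $i$. In an abelian category, $\operatorname{im}(f)=\ker(\operatorname{coker}(f))$. *)

theory Defs
  imports "HOL-Algebra.Group"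
begin

section \<open>Categories\<close>

text \<open>Objects and arrows are the elements of the two carrier sets; composition, identities etc.
  are unspecified outside of them.\<close>

record ('o, 'm) category =
  Obj :: "'o set"
  Arr :: "'m set"
  Dom :: "'m \<Rightarrow> 'o"
  Cod :: "'m \<Rightarrow> 'o"
  Ident :: "'o \<Rightarrow> 'm"
  Comp :: "'m \<Rightarrow> 'm \<Rightarrow> 'm"  (infixr \<open>\<odot>\<index>\<close> 75)

definition Hom :: "('o, 'm, 'x) category_scheme \<Rightarrow> 'o \<Rightarrow> 'o \<Rightarrow> 'm set"
  where "Hom C A B = {f \<in> Arr C. Dom C f = A \<and> Cod C f = B}"

locale category =
  fixes C :: "('o, 'm, 'x) category_scheme" (structure)
  assumes Dom_in_Obj: "f \<in> Arr C \<Longrightarrow> Dom C f \<in> Obj C"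
    and Cod_in_Obj: "f \<in> Arr C \<Longrightarrow> Cod C f \<in> Obj C"
    and Ident_in_Hom: "A \<in> Obj C \<Longrightarrow> Ident C A \<in> Hom C A A"
    and Comp_in_Hom: "\<lbrakk>f \<in> Hom C A B; g \<in> Hom C B D\<rbrakk> \<Longrightarrow> g \<odot> f \<in> Hom C A D"
    and Comp_Ident: "f \<in> Hom C A B \<Longrightarrow> f \<odot> Ident C A = f"
    and Ident_Comp: "f \<in> Hom C A B \<Longrightarrow> Ident C B \<odot> f = f"
    and Comp_assoc: "\<lbrakk>f \<in> Hom C A B; g \<in> Hom C B D; h \<in> Hom C D E\<rbrakk>
          \<Longrightarrow> (h \<odot> g) \<odot> f = h \<odot> (g \<odot> f)"

definition is_isomorphism :: "('o, 'm, 'x) category_scheme \<Rightarrow> 'm \<Rightarrow> bool"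
  where "is_isomorphism C u \<longleftrightarrow> u \<in> Arr C \<and>
    (\<exists>v \<in> Hom C (Cod C u) (Dom C u).
        v \<odot>\<^bsub>C\<^esub> u = Ident C (Dom C u) \<and> u \<odot>\<^bsub>C\<^esub> v = Ident C (Cod C u))"

definition is_mono :: "('o, 'm, 'x) category_scheme \<Rightarrow> 'm \<Rightarrow> bool"
  where "is_mono C u \<longleftrightarrow> u \<in> Arr C \<and>
    (\<forall>A \<in> Obj C. \<forall>v \<in> Hom C A (Dom C u). \<forall>w \<in> Hom C A (Dom C u).
        u \<odot>\<^bsub>C\<^esub> v = u \<odot>\<^bsub>C\<^esub> w \<longrightarrow> v = w)"

definition is_epi :: "('o, 'm, 'x) category_scheme \<Rightarrow> 'm \<Rightarrow> bool"
  where "is_epi C u \<longleftrightarrow> u \<in> Arr C \<and>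
    (\<forall>A \<in> Obj C. \<forall>v \<in> Hom C (Cod C u) A. \<forall>w \<in> Hom C (Cod C u) A.
        v \<odot>\<^bsub>C\<^esub> u = w \<odot>\<^bsub>C\<^esub> u \<longrightarrow> v = w)"

definition is_zero_object :: "('o, 'm, 'x) category_scheme \<Rightarrow> 'o \<Rightarrow> bool"
  where "is_zero_object C Z \<longleftrightarrow> Z \<in> Obj C \<and>
    (\<forall>A \<in> Obj C. (\<exists>!f. f \<in> Hom C Z A) \<and> (\<exists>!f. f \<in> Hom C A Z))"

section \<open>Abelian categories\<close>

text \<open>Following Mac Lane: an Ab-category has abelian groups as hom-sets and bilinear composition;
  it is abelian if it has a zero object, binary biproducts, kernels and cokernels, every
  monomorphism is a kernel and every epimorphism is a cokernel.\<close>

record ('o, 'm) ab_category = "('o, 'm) category" +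
  Plus :: "'m \<Rightarrow> 'm \<Rightarrow> 'm"  (infixl \<open>\<boxplus>\<index>\<close> 65)
  Zero :: "'o \<Rightarrow> 'o \<Rightarrow> 'm"

definition hom_group :: "('o, 'm, 'x) ab_category_scheme \<Rightarrow> 'o \<Rightarrow> 'o \<Rightarrow> 'm monoid"
  where "hom_group C A B = \<lparr>carrier = Hom C A B, mult = Plus C, one = Zero C A B\<rparr>"

locale ab_category = category C
  for C :: "('o, 'm, 'x) ab_category_scheme" (structure) +
  assumes hom_comm_group: "\<lbrakk>A \<in> Obj C; B \<in> Obj C\<rbrakk> \<Longrightarrow> comm_group (hom_group C A B)"
    and Comp_Plus_left: "\<lbrakk>f \<in> Hom C A B; g \<in> Hom C B D; g' \<in> Hom C B D\<rbrakk>
          \<Longrightarrow> (g \<boxplus> g') \<odot> f = (g \<odot> f) \<boxplus> (g' \<odot> f)"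
    and Comp_Plus_right: "\<lbrakk>f \<in> Hom C A B; f' \<in> Hom C A B; g \<in> Hom C B D\<rbrakk>
          \<Longrightarrow> g \<odot> (f \<boxplus> f') = (g \<odot> f) \<boxplus> (g \<odot> f')"

definition is_biproduct ::
    "('o, 'm, 'x) ab_category_scheme \<Rightarrow> 'o \<Rightarrow> 'o \<Rightarrow> 'o \<Rightarrow> 'm \<Rightarrow> 'm \<Rightarrow> 'm \<Rightarrow> 'm \<Rightarrow> bool"
  where "is_biproduct C A B P p q i j \<longleftrightarrow>
    P \<in> Obj C \<and> p \<in> Hom C P A \<and> q \<in> Hom C P B \<and> i \<in> Hom C A P \<and> j \<in> Hom C B P \<and>
    p \<odot>\<^bsub>C\<^esub> i = Ident C A \<and> q \<odot>\<^bsub>C\<^esub> j = Ident C B \<and>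
    (i \<odot>\<^bsub>C\<^esub> p) \<boxplus>\<^bsub>C\<^esub> (j \<odot>\<^bsub>C\<^esub> q) = Ident C P"

definition is_kernel :: "('o, 'm, 'x) ab_category_scheme \<Rightarrow> 'm \<Rightarrow> 'm \<Rightarrow> bool"
  where "is_kernel C f k \<longleftrightarrow>
    f \<in> Arr C \<and> k \<in> Arr C \<and> Cod C k = Dom C f \<and> f \<odot>\<^bsub>C\<^esub> k = Zero C (Dom C k) (Cod C f) \<and>
    (\<forall>h \<in> Arr C. Cod C h = Dom C f \<and> f \<odot>\<^bsub>C\<^esub> h = Zero C (Dom C h) (Cod C f) \<longrightarrow>
       (\<exists>!u. u \<in> Hom C (Dom C h) (Dom C k) \<and> k \<odot>\<^bsub>C\<^esub> u = h))"

definition is_cokernel :: "('o, 'm, 'x) ab_category_scheme \<Rightarrow> 'm \<Rightarrow> 'm \<Rightarrow> bool"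
  where "is_cokernel C f c \<longleftrightarrow>
    f \<in> Arr C \<and> c \<in> Arr C \<and> Dom C c = Cod C f \<and> c \<odot>\<^bsub>C\<^esub> f = Zero C (Dom C f) (Cod C c) \<and>
    (\<forall>h \<in> Arr C. Dom C h = Cod C f \<and> h \<odot>\<^bsub>C\<^esub> f = Zero C (Dom C f) (Cod C h) \<longrightarrow>
       (\<exists>!u. u \<in> Hom C (Cod C c) (Cod C h) \<and> u \<odot>\<^bsub>C\<^esub> c = h))"

locale abelian_category = ab_category C
  for C :: "('o, 'm, 'x) ab_category_scheme" (structure) +
  assumes ex_zero_object: "\<exists>Z. is_zero_object C Z"
    and ex_biproduct: "\<lbrakk>A \<in> Obj C; B \<in> Obj C\<rbrakk> \<Longrightarrow> \<exists>P p q i j. is_biproduct C A B P p q i j"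
    and ex_kernel: "f \<in> Arr C \<Longrightarrow> \<exists>k. is_kernel C f k"
    and ex_cokernel: "f \<in> Arr C \<Longrightarrow> \<exists>c. is_cokernel C f c"
    and mono_is_kernel: "is_mono C m \<Longrightarrow> \<exists>f. is_kernel C f m"
    and epi_is_cokernel: "is_epi C e \<Longrightarrow> \<exists>f. is_cokernel C f e"

section \<open>Kernels, images, exactness\<close>

text \<open>Kernels, cokernels and images are arbitrarily chosen representatives, and they are arrows
  rather than objects: the object underlying the kernel is the domain of \<open>ker_arr C f\<close>.\<close>

definition ker_arr :: "('o, 'm, 'x) ab_category_scheme \<Rightarrow> 'm \<Rightarrow> 'm"
  where "ker_arr C f = (SOME k. is_kernel C f k)"

definition coker_arr :: "('o, 'm, 'x) ab_category_scheme \<Rightarrow> 'm \<Rightarrow> 'm"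
  where "coker_arr C f = (SOME c. is_cokernel C f c)"

definition im_arr :: "('o, 'm, 'x) ab_category_scheme \<Rightarrow> 'm \<Rightarrow> 'm"
  where "im_arr C f = ker_arr C (coker_arr C f)"

text \<open>The canonical map from the image of \<open>f\<close> to the kernel of \<open>g\<close> is meaningful only if
  \<open>g \<odot> f\<close> is zero.\<close>

definition im_to_ker :: "('o, 'm, 'x) ab_category_scheme \<Rightarrow> 'm \<Rightarrow> 'm \<Rightarrow> 'm"
  where "im_to_ker C f g =
    (THE u. u \<in> Hom C (Dom C (im_arr C f)) (Dom C (ker_arr C g)) \<and> ker_arr C g \<odot>\<^bsub>C\<^esub> u = im_arr C f)"

definition subobject_le :: "('o, 'm, 'x) category_scheme \<Rightarrow> 'm \<Rightarrow> 'm \<Rightarrow> bool"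
  where "subobject_le C u v \<longleftrightarrow>
    is_mono C u \<and> is_mono C v \<and> Cod C u = Cod C v \<and> (\<exists>w \<in> Hom C (Dom C u) (Dom C v). v \<odot>\<^bsub>C\<^esub> w = u)"

text \<open>Exactness: the image of \<open>f\<close> and the kernel of \<open>g\<close> are the same subobject of the
  object in the middle.\<close>

definition exact_at_middle :: "('o, 'm, 'x) ab_category_scheme \<Rightarrow> 'm \<Rightarrow> 'm \<Rightarrow> bool"
  where "exact_at_middle C f g \<longleftrightarrow> f \<in> Arr C \<and> g \<in> Arr C \<and> Cod C f = Dom C g \<and>
    subobject_le C (im_arr C f) (ker_arr C g) \<and> subobject_le C (ker_arr C g) (im_arr C f)"

section \<open>Functor categories\<close>

record ('i, 'j, 'o, 'm) functor_data =
  FObj :: "'i \<Rightarrow> 'o"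
  FArr :: "'j \<Rightarrow> 'm"

record ('i, 'j, 'o, 'm) transformation =
  Source :: "('i, 'j, 'o, 'm) functor_data"
  Target :: "('i, 'j, 'o, 'm) functor_data"
  Component :: "'i \<Rightarrow> 'm"

text \<open>Functors and natural transformations are extensional functions on the carriers (via
  \<open>\<rightarrow>\<^sub>E\<close>), so that equality of the HOL values is the mathematical equality.\<close>

definition is_functor ::
    "('i, 'j, 'x) category_scheme \<Rightarrow> ('o, 'm, 'y) category_scheme
      \<Rightarrow> ('i, 'j, 'o, 'm) functor_data \<Rightarrow> bool"
  where "is_functor I C F \<longleftrightarrow>
    FObj F \<in> Obj I \<rightarrow>\<^sub>E Obj C \<and>
    FArr F \<in> Arr I \<rightarrow>\<^sub>E Arr C \<and>
    (\<forall>a \<in> Arr I. FArr F a \<in> Hom C (FObj F (Dom I a)) (FObj F (Cod I a))) \<and>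
    (\<forall>i \<in> Obj I. FArr F (Ident I i) = Ident C (FObj F i)) \<and>
    (\<forall>a \<in> Arr I. \<forall>b \<in> Arr I. Cod I a = Dom I b \<longrightarrow>
        FArr F (b \<odot>\<^bsub>I\<^esub> a) = FArr F b \<odot>\<^bsub>C\<^esub> FArr F a)"

definition is_natural ::
    "('i, 'j, 'x) category_scheme \<Rightarrow> ('o, 'm, 'y) category_scheme
      \<Rightarrow> ('i, 'j, 'o, 'm) transformation \<Rightarrow> bool"
  where "is_natural I C t \<longleftrightarrow>
    is_functor I C (Source t) \<and> is_functor I C (Target t) \<and>
    Component t \<in> Obj I \<rightarrow>\<^sub>E Arr C \<and>
    (\<forall>i \<in> Obj I. Component t i \<in> Hom C (FObj (Source t) i) (FObj (Target t) i)) \<and>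
    (\<forall>a \<in> Arr I. Component t (Cod I a) \<odot>\<^bsub>C\<^esub> FArr (Source t) a
        = FArr (Target t) a \<odot>\<^bsub>C\<^esub> Component t (Dom I a))"

definition functor_category ::
    "('i, 'j, 'x) category_scheme \<Rightarrow> ('o, 'm, 'y) ab_category_scheme
      \<Rightarrow> (('i, 'j, 'o, 'm) functor_data, ('i, 'j, 'o, 'm) transformation) ab_category"
  where "functor_category I C =
    \<lparr>Obj = {F. is_functor I C F},
     Arr = {t. is_natural I C t},
     Dom = Source,
     Cod = Target,
     Ident = (\<lambda>F. \<lparr>Source = F, Target = F, Component = (\<lambda>i \<in> Obj I. Ident C (FObj F i))\<rparr>),
     Comp = (\<lambda>t s. \<lparr>Source = Source s, Target = Target t,
                    Component = (\<lambda>i \<in> Obj I. Component t i \<odot>\<^bsub>C\<^esub> Component s i)\<rparr>),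
     Plus = (\<lambda>s t. \<lparr>Source = Source s, Target = Target s,
                    Component = (\<lambda>i \<in> Obj I. Component s i \<boxplus>\<^bsub>C\<^esub> Component t i)\<rparr>),
     Zero = (\<lambda>F G. \<lparr>Source = F, Target = G,
                    Component = (\<lambda>i \<in> Obj I. Zero C (FObj F i) (FObj G i))\<rparr>)\<rparr>"

end

theory Submission
  imports Defs
begin

text \<open>If \<open>c\<close> is any cokernel of \<open>f\<close> and \<open>k\<close> any kernel of \<open>c\<close>, then exactness at the middle
  means that \<open>k\<close> is also a kernel of \<open>g\<close>. Kernels in a functor category are exactly the pointwise
  kernels (the pointwise induced maps are natural because kernels are monic), and dually for
  cokernels, so this criterion may be tested pointwise.
  Of the additive structure, only the zero arrows matter.\<close>

section \<open>Categories with zero arrows\<close>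

text \<open>Kernels, cokernels and images are picked by \<open>SOME\<close>, and the choices made
  for functors are unrelated to those made in \<open>C\<close>: a component of \<open>im_arr\<close>
  need not be the \<open>im_arr\<close> of the component. Hence the criterion has to admit arbitrary
  representatives, and being a kernel has to be shown to depend only on the subobject. That a kernel
  of a transformation has kernels as components does not follow from its universal property alone,
  which speaks about natural families and not about arrows into a single component. A kernel is
  therefore built from kernels in \<open>C\<close>, and any other one is compared with it up to
  isomorphism. Duality needs care as well: functors between opposite categories are the same records
  as before, but a transformation stores its source and target, so the functor category of the
  opposites is only isomorphic to the opposite of the functor category.\<close>

locale zero_category = category C
  for C :: "('o, 'm, 'x) ab_category_scheme" (structure) +
  assumes Zero_in_Hom: "\<lbrakk>A \<in> Obj C; B \<in> Obj C\<rbrakk> \<Longrightarrow> Zero C A B \<in> Hom C A B"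
    and Comp_Zero: "\<lbrakk>A \<in> Obj C; f \<in> Hom C B D\<rbrakk> \<Longrightarrow> f \<odot> Zero C A B = Zero C A D"
    and Zero_Comp: "\<lbrakk>f \<in> Hom C A B; D \<in> Obj C\<rbrakk> \<Longrightarrow> Zero C B D \<odot> f = Zero C A D"

lemma Hom_self_iff: "f \<in> Hom C (Dom C f) (Cod C f) \<longleftrightarrow> f \<in> Arr C"
  by (simp add: Hom_def)

context category
begin

lemma Hom_Obj:
  assumes "f \<in> Hom C A B"
  shows "A \<in> Obj C" "B \<in> Obj C"
  using assms Dom_in_Obj Cod_in_Obj by (auto simp: Hom_def)

lemma is_mono_iff:
  assumes "u \<in> Hom C B D"
  shows "is_mono C u \<longleftrightarrow> (\<forall>A. \<forall>v \<in> Hom C A B. \<forall>w \<in> Hom C A B. u \<odot> v = u \<odot> w \<longrightarrow> v = w)"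
proof -
  have "u \<in> Arr C" "Dom C u = B"
    using assms by (simp_all add: Hom_def)
  then show ?thesis
    unfolding is_mono_def using Hom_Obj(1) by blast
qed

lemma is_mono_cancel:
  assumes "is_mono C u" "u \<in> Hom C B D" "v \<in> Hom C A B" "w \<in> Hom C A B" "u \<odot> v = u \<odot> w"
  shows "v = w"
  using assms is_mono_iff by blast

end

context ab_category
begin

text \<open>In a group the neutral element is the only idempotent. By bilinearity, a composite with
  a zero arrow is idempotent, which gives both absorption laws.\<close>

sublocale zero_category
proof
  show zero: "Zero C A B \<in> Hom C A B" if "A \<in> Obj C" "B \<in> Obj C" for A B
    using comm_group.axioms(2)[OF hom_comm_group[OF that]] group.is_monoid monoid.one_closed
    by (fastforce simp: hom_group_def)
  have idem: "h = Zero C A B" if "h \<in> Hom C A B" "h \<boxplus> h = h" for h A B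
  proof -
    interpret G: comm_group "hom_group C A B"
      using that(1) by (intro hom_comm_group) (auto dest: Hom_Obj)
    show ?thesis
      using G.l_cancel_one[of h h] that by (simp add: hom_group_def)
  qed
  have zero_idem: "Zero C A B \<boxplus> Zero C A B = Zero C A B" if "A \<in> Obj C" "B \<in> Obj C" for A B
  proof -
    interpret G: comm_group "hom_group C A B"
      using that by (rule hom_comm_group)
    show ?thesis
      using G.l_one[OF G.one_closed] by (simp add: hom_group_def)
  qed
  show "f \<odot> Zero C A B = Zero C A D" if "A \<in> Obj C" "f \<in> Hom C B D" for A B D f
  proof (rule idem)
    have z: "Zero C A B \<in> Hom C A B" using that Hom_Obj zero by blast
    then show "f \<odot> Zero C A B \<in> Hom C A D" using that Comp_in_Hom by blast
    show "(f \<odot> Zero C A B) \<boxplus> (f \<odot> Zero C A B) = f \<odot> Zero C A B"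
      using Comp_Plus_right[OF z z that(2)] zero_idem that Hom_Obj by metis
  qed
  show "Zero C B D \<odot> f = Zero C A D" if "f \<in> Hom C A B" "D \<in> Obj C" for A B D f
  proof (rule idem)
    have z: "Zero C B D \<in> Hom C B D" using that Hom_Obj zero by blast
    then show "Zero C B D \<odot> f \<in> Hom C A D" using that Comp_in_Hom by blast
    show "(Zero C B D \<odot> f) \<boxplus> (Zero C B D \<odot> f) = Zero C B D \<odot> f"
      using Comp_Plus_left[OF that(1) z z] zero_idem that Hom_Obj by metis
  qed
qed

end

section \<open>Kernels and exactness\<close>

context zero_category
begin

text \<open>Naming the objects turns the \<open>Dom\<close> and \<open>Cod\<close> equations of the
  definition into hom-sets; in this form kernels can be compared between different arrows and
  between different categories.\<close>

lemma is_kernel_iff: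
  assumes "f \<in> Hom C B D" "k \<in> Hom C K B"
  shows "is_kernel C f k \<longleftrightarrow> f \<odot> k = Zero C K D \<and>
    (\<forall>A. \<forall>h \<in> Hom C A B. f \<odot> h = Zero C A D \<longrightarrow> (\<exists>!u. u \<in> Hom C A K \<and> k \<odot> u = h))"
proof -
  have f: "f \<in> Arr C" "Dom C f = B" "Cod C f = D" and k: "k \<in> Arr C" "Dom C k = K" "Cod C k = B"
    using assms by (simp_all add: Hom_def)
  \<comment> \<open>Abstract predicates keep the unique existence opaque, so that only the change of
    quantifiers is proved here.\<close>
  have h: "(\<forall>h \<in> Arr C. Cod C h = B \<and> P h (Dom C h) \<longrightarrow> Q h (Dom C h)) \<longleftrightarrow>
      (\<forall>A. \<forall>h \<in> Hom C A B. P h A \<longrightarrow> Q h A)" for P Q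
    unfolding Hom_def by blast
  have "(\<forall>h \<in> Arr C. Cod C h = B \<and> f \<odot> h = Zero C (Dom C h) D \<longrightarrow>
        (\<exists>!u. u \<in> Hom C (Dom C h) K \<and> k \<odot> u = h)) \<longleftrightarrow>
      (\<forall>A. \<forall>h \<in> Hom C A B. f \<odot> h = Zero C A D \<longrightarrow> (\<exists>!u. u \<in> Hom C A K \<and> k \<odot> u = h))"
    by (rule h)
  then show ?thesis
    unfolding is_kernel_def f k by (simp only: f(1) k(1) simp_thms)
qed

lemma is_kernel_self_Hom:
  assumes "is_kernel C f k"
  shows "f \<in> Hom C (Dom C f) (Cod C f)" "k \<in> Hom C (Dom C k) (Dom C f)"
proof -
  have "f \<in> Arr C \<and> k \<in> Arr C \<and> Cod C k = Dom C f"
    using assms unfolding is_kernel_def by (elim conjE) (intro conjI)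
  then show "f \<in> Hom C (Dom C f) (Cod C f)" "k \<in> Hom C (Dom C k) (Dom C f)"
    by (simp_all add: Hom_def)
qed

lemma is_kernel_Hom:
  assumes "is_kernel C f k" "f \<in> Hom C B D"
  shows "k \<in> Hom C (Dom C k) B"
  using is_kernel_self_Hom(2)[OF assms(1)] assms(2) by (simp add: Hom_def)

lemma is_kernel_Comp:
  assumes "is_kernel C f k" "f \<in> Hom C B D"
  shows "f \<odot> k = Zero C (Dom C k) D"
  using assms(1) unfolding is_kernel_iff[OF assms(2) is_kernel_Hom[OF assms]] by (rule conjunct1)

lemma is_cokernel_self_Hom:
  assumes "is_cokernel C f c"
  shows "f \<in> Hom C (Dom C f) (Cod C f)" "c \<in> Hom C (Cod C f) (Cod C c)"
proof -
  have "f \<in> Arr C \<and> c \<in> Arr C \<and> Dom C c = Cod C f"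
    using assms unfolding is_cokernel_def by (elim conjE) (intro conjI)
  then show "f \<in> Hom C (Dom C f) (Cod C f)" "c \<in> Hom C (Cod C f) (Cod C c)"
    by (simp_all add: Hom_def)
qed

lemma is_cokernel_Hom:
  assumes "is_cokernel C f c" "f \<in> Hom C B D"
  shows "c \<in> Hom C D (Cod C c)"
  using is_cokernel_self_Hom(2)[OF assms(1)] assms(2) by (simp add: Hom_def)

lemma is_cokernel_Comp:
  assumes "is_cokernel C f c" "f \<in> Hom C B D"
  shows "c \<odot> f = Zero C B (Cod C c)"
proof -
  have "c \<odot> f = Zero C (Dom C f) (Cod C c)"
    using assms(1) unfolding is_cokernel_def by (elim conjE)
  then show ?thesis using assms(2) by (simp add: Hom_def)
qed

lemma kernel_factors:
  assumes "is_kernel C f k" "f \<in> Hom C B D" "h \<in> Hom C A B" "f \<odot> h = Zero C A D"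
  obtains u where "u \<in> Hom C A (Dom C k)" "k \<odot> u = h"
  using assms is_kernel_iff[OF assms(2) is_kernel_Hom[OF assms(1,2)]] by blast

lemma cokernel_factors:
  assumes "is_cokernel C f c" "f \<in> Hom C B D" "h \<in> Hom C D A" "h \<odot> f = Zero C B A"
  obtains u where "u \<in> Hom C (Cod C c) A" "u \<odot> c = h"
proof -
  have "h \<in> Arr C" "Dom C h = D" "Cod C h = A" "Dom C f = B" "Cod C f = D"
    using assms by (simp_all add: Hom_def)
  then show thesis using that assms unfolding is_cokernel_def by metis
qed

text \<open>If \<open>k \<odot> v = k \<odot> w\<close>, then \<open>v\<close> and \<open>w\<close>
  factor one and the same arrow through \<open>k\<close>. This arrow is annihilated by
  \<open>f\<close>, so its factorisation is unique.\<close>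

lemma kernel_is_mono:
  assumes "is_kernel C f k"
  shows "is_mono C k"
proof -
  define B D K where "B = Dom C f" "D = Cod C f" "K = Dom C k"
  then have f: "f \<in> Hom C B D" and k: "k \<in> Hom C K B"
    using is_kernel_self_Hom[OF assms] by simp_all
  show ?thesis unfolding is_mono_iff[OF k]
  proof (intro allI ballI impI)
    fix A v w
    assume v: "v \<in> Hom C A K" and w: "w \<in> Hom C A K" and eq: "k \<odot> v = k \<odot> w"
    have D: "D \<in> Obj C" using f Hom_Obj by blast
    have "f \<odot> (k \<odot> v) = Zero C A D"
      using Comp_assoc[OF v k f] assms Zero_Comp[OF v D] is_kernel_iff[OF f k] by simp
    moreover have "k \<odot> v \<in> Hom C A B" using v k Comp_in_Hom by blast
    ultimately have "\<exists>!u. u \<in> Hom C A K \<and> k \<odot> u = k \<odot> v"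
      using assms is_kernel_iff[OF f k] by blast
    then show "v = w" using v w eq by auto
  qed
qed

text \<open>The universal property of \<open>k'\<close> provides the factorisation. Used in both
  directions, it makes any two kernels of \<open>f\<close> the same subobject.\<close>

lemma kernel_subobject_le:
  assumes "is_kernel C f k" "is_kernel C f k'"
  shows "subobject_le C k k'"
proof -
  define B D where "B = Dom C f" "D = Cod C f"
  then have f: "f \<in> Hom C B D"
    using is_kernel_self_Hom[OF assms(1)] by simp
  have k: "k \<in> Hom C (Dom C k) B" and k': "k' \<in> Hom C (Dom C k') B"
    using assms f is_kernel_Hom by blast+
  obtain w where "w \<in> Hom C (Dom C k) (Dom C k')" "k' \<odot> w = k"
    using kernel_factors[OF assms(2) f k is_kernel_Comp[OF assms(1) f]] by blast
  then show ?thesis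
    using assms kernel_is_mono k k' by (auto simp: subobject_le_def Hom_def)
qed

text \<open>Factorisations through \<open>k\<close> become factorisations through \<open>k'\<close>
  by composing with the comparison arrow \<open>w\<close>. Their uniqueness is the monicity of
  \<open>k'\<close>, which \<open>subobject_le\<close> contains.\<close>

lemma kernel_of_same_subobject:
  assumes "is_kernel C f k" "subobject_le C k k'" "subobject_le C k' k"
  shows "is_kernel C f k'"
proof -
  define B D K K' where "B = Dom C f" "D = Cod C f" "K = Dom C k" "K' = Dom C k'"
  then have f: "f \<in> Hom C B D" and k: "k \<in> Hom C K B"
    using is_kernel_self_Hom[OF assms(1)] by simp_all
  have "k' \<in> Arr C" "Cod C k' = Cod C k"
    using assms(2) unfolding subobject_le_def is_mono_def by simp_all
  then have k': "k' \<in> Hom C K' B"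
    using k unfolding B_D_K_K'_def Hom_def by simp
  obtain w where w: "w \<in> Hom C K K'" "k' \<odot> w = k"
    using assms(2) unfolding subobject_le_def B_D_K_K'_def by blast
  obtain w' where w': "w' \<in> Hom C K' K" "k \<odot> w' = k'"
    using assms(3) unfolding subobject_le_def B_D_K_K'_def by blast
  have mono: "is_mono C k'" using assms(2) by (simp add: subobject_le_def)
  have D: "D \<in> Obj C" using f Hom_Obj by blast
  have "f \<odot> k' = Zero C K' D"
    using Comp_assoc[OF w'(1) k f] w'(2) Zero_Comp[OF w'(1) D] assms(1) is_kernel_iff[OF f k]
    by simp
  moreover have "\<exists>!u. u \<in> Hom C A K' \<and> k' \<odot> u = h"
    if h: "h \<in> Hom C A B" "f \<odot> h = Zero C A D" for A h
  proof -
    obtain u where u: "u \<in> Hom C A K" "k \<odot> u = h"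
      using assms(1) h is_kernel_iff[OF f k] by blast
    then have "w \<odot> u \<in> Hom C A K'" "k' \<odot> (w \<odot> u) = h"
      using w Comp_in_Hom Comp_assoc[OF u(1) w(1) k'] by auto
    then show ?thesis using is_mono_cancel[OF mono k'] by metis
  qed
  ultimately show ?thesis using is_kernel_iff[OF f k'] by blast
qed

text \<open>Precomposing with an isomorphism leaves the subobject unchanged: \<open>w\<close> and
  \<open>w'\<close> are themselves the comparison arrows.\<close>

lemma kernel_comp_iso:
  assumes k: "is_kernel C f k" "k \<in> Hom C K B"
    and w: "w \<in> Hom C K' K" "w' \<in> Hom C K K'" "w' \<odot> w = Ident C K'" "w \<odot> w' = Ident C K"
  shows "is_kernel C f (k \<odot> w)"
proof (rule kernel_of_same_subobject[OF k(1)])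
  have mono: "is_mono C k" using k kernel_is_mono by blast
  have kw: "k \<odot> w \<in> Hom C K' B" using k w Comp_in_Hom by blast
  have kw_w': "(k \<odot> w) \<odot> w' = k"
    using Comp_assoc[OF w(2,1) k(2)] w k(2) Comp_Ident by simp
  have mono': "is_mono C (k \<odot> w)" unfolding is_mono_iff[OF kw]
  proof (intro allI ballI impI)
    fix A v v'
    assume v: "v \<in> Hom C A K'" and v': "v' \<in> Hom C A K'" and "(k \<odot> w) \<odot> v = (k \<odot> w) \<odot> v'"
    then have "k \<odot> (w \<odot> v) = k \<odot> (w \<odot> v')"
      using Comp_assoc[OF v w(1) k(2)] Comp_assoc[OF v' w(1) k(2)] by simp
    then have "w \<odot> v = w \<odot> v'"
      using is_mono_cancel[OF mono k(2)] v v' w Comp_in_Hom by blast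
    then show "v = v'"
      using Comp_assoc[OF v w(1,2)] Comp_assoc[OF v' w(1,2)] w Ident_Comp v v' by metis
  qed
  show "subobject_le C k (k \<odot> w)" "subobject_le C (k \<odot> w) k"
    using mono mono' kw k w kw_w' unfolding subobject_le_def by (auto simp: Hom_def)
qed

text \<open>The two comparison arrows are mutually inverse because they are so after composing with
  the monic arrows \<open>k\<close> and \<open>k'\<close>.\<close>

lemma kernels_iso:
  assumes "is_kernel C f k" "is_kernel C f k'"
  obtains w w' where "w \<in> Hom C (Dom C k) (Dom C k')" "w' \<in> Hom C (Dom C k') (Dom C k)"
    "k' \<odot> w = k" "w' \<odot> w = Ident C (Dom C k)" "w \<odot> w' = Ident C (Dom C k')"
proof -
  obtain w where w: "w \<in> Hom C (Dom C k) (Dom C k')" "k' \<odot> w = k"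
    using kernel_subobject_le[OF assms] unfolding subobject_le_def by blast
  obtain w' where w': "w' \<in> Hom C (Dom C k') (Dom C k)" "k \<odot> w' = k'"
    using kernel_subobject_le[OF assms(2,1)] unfolding subobject_le_def by blast
  have k: "k \<in> Hom C (Dom C k) (Dom C f)" and k': "k' \<in> Hom C (Dom C k') (Dom C f)"
    using assms is_kernel_self_Hom by blast+
  have "k \<odot> (w' \<odot> w) = k \<odot> Ident C (Dom C k)"
    using Comp_assoc[OF w(1) w'(1) k] w w' k Comp_Ident by simp
  then have 1: "w' \<odot> w = Ident C (Dom C k)"
    using is_mono_cancel[OF kernel_is_mono[OF assms(1)] k] w w' k Comp_in_Hom Ident_in_Hom Hom_Obj
    by metis
  have "k' \<odot> (w \<odot> w') = k' \<odot> Ident C (Dom C k')"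
    using Comp_assoc[OF w'(1) w(1) k'] w w' k' Comp_Ident by simp
  then have "w \<odot> w' = Ident C (Dom C k')"
    using is_mono_cancel[OF kernel_is_mono[OF assms(2)] k'] w w' k' Comp_in_Hom Ident_in_Hom Hom_Obj
    by metis
  with 1 w w' that show thesis by blast
qed

text \<open>Two cokernels of \<open>f\<close> factor through each other, so they annihilate the same
  arrows; and a kernel is determined by which arrows are annihilated.\<close>

lemma kernel_of_cokernel_unique:
  assumes c: "is_cokernel C f c" "is_cokernel C f c'" and k: "is_kernel C c k"
  shows "is_kernel C c' k"
proof -
  define B D E E' K where "B = Dom C f" "D = Cod C f" "E = Cod C c" "E' = Cod C c'" "K = Dom C k"
  then have f: "f \<in> Hom C B D" and c_Hom: "c \<in> Hom C D E" and c'_Hom: "c' \<in> Hom C D E'"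
    using is_cokernel_self_Hom[OF c(1)] is_cokernel_self_Hom[OF c(2)] by simp_all
  have k_Hom: "k \<in> Hom C K D"
    using is_kernel_Hom[OF k c_Hom] unfolding B_D_E_E'_K_def .
  obtain w where w: "w \<in> Hom C E E'" "w \<odot> c = c'"
    using cokernel_factors[OF c(1) f c'_Hom] is_cokernel_Comp[OF c(2) f] unfolding B_D_E_E'_K_def
    by blast
  obtain w' where w': "w' \<in> Hom C E' E" "w' \<odot> c' = c"
    using cokernel_factors[OF c(2) f c_Hom] is_cokernel_Comp[OF c(1) f] unfolding B_D_E_E'_K_def
    by blast
  have "c \<odot> h = Zero C A E \<longleftrightarrow> c' \<odot> h = Zero C A E'" if h: "h \<in> Hom C A D" for A h
  proof -
    have "w \<odot> (c \<odot> h) = c' \<odot> h" "w' \<odot> (c' \<odot> h) = c \<odot> h"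
      using Comp_assoc[OF h c_Hom w(1)] Comp_assoc[OF h c'_Hom w'(1)] w(2) w'(2) by simp_all
    moreover have "w \<odot> Zero C A E = Zero C A E'" "w' \<odot> Zero C A E' = Zero C A E"
      using Comp_Zero[OF Hom_Obj(1)[OF h]] w(1) w'(1) by blast+
    ultimately show ?thesis by metis
  qed
  then show ?thesis
    using k k_Hom unfolding is_kernel_iff[OF c_Hom k_Hom] is_kernel_iff[OF c'_Hom k_Hom] by blast
qed

end

section \<open>Exactness in categories with kernels and cokernels\<close>

locale kernel_cokernel_category = zero_category C
  for C :: "('o, 'm, 'x) ab_category_scheme" (structure) +
  assumes ex_kernel: "f \<in> Arr C \<Longrightarrow> \<exists>k. is_kernel C f k"
    and ex_cokernel: "f \<in> Arr C \<Longrightarrow> \<exists>c. is_cokernel C f c"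
begin

lemma ker_arr_is_kernel: "f \<in> Arr C \<Longrightarrow> is_kernel C f (ker_arr C f)"
  unfolding ker_arr_def by (rule someI_ex) (rule ex_kernel)

lemma coker_arr_is_cokernel: "f \<in> Arr C \<Longrightarrow> is_cokernel C f (coker_arr C f)"
  unfolding coker_arr_def by (rule someI_ex) (rule ex_cokernel)

lemma im_arr_is_kernel:
  assumes "f \<in> Arr C"
  shows "is_kernel C (coker_arr C f) (im_arr C f)"
  using ker_arr_is_kernel coker_arr_is_cokernel[OF assms]
  by (simp add: im_arr_def is_cokernel_def)

text \<open>This form frees exactness from the chosen image and kernel, so that it can be applied to
  components of representatives chosen in another category.\<close>

theorem exact_at_middle_iff_kernel:
  assumes f: "f \<in> Hom C L M" and g: "g \<in> Hom C M N"
    and c: "is_cokernel C f c" and k: "is_kernel C c k"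
  shows "exact_at_middle C f g \<longleftrightarrow> is_kernel C g k"
proof -
  have arr: "f \<in> Arr C" "g \<in> Arr C" "Cod C f = Dom C g" using f g by (auto simp: Hom_def)
  have im: "is_kernel C (coker_arr C f) (im_arr C f)" and ker: "is_kernel C g (ker_arr C g)"
    using arr im_arr_is_kernel ker_arr_is_kernel by auto
  have k': "is_kernel C (coker_arr C f) k"
    using kernel_of_cokernel_unique c k coker_arr_is_cokernel arr by blast
  \<comment> \<open>Kernels of \<open>g\<close> form one class of equal subobjects, so the image
    equals \<open>ker_arr C g\<close> as a subobject just when it is itself a kernel of
    \<open>g\<close>.\<close>
  have "exact_at_middle C f g \<longleftrightarrow> is_kernel C g (im_arr C f)"
    using arr ker kernel_subobject_le kernel_of_same_subobject unfolding exact_at_middle_def by blast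
  also have "\<dots> \<longleftrightarrow> is_kernel C g k"
    using im k' kernel_subobject_le kernel_of_same_subobject by blast
  finally show ?thesis .
qed

text \<open>Since \<open>g \<odot> f\<close> is zero, the image always lies in the kernel, and the
  canonical map witnesses this. Exactness adds the reverse inclusion, whose witness is forced to be
  the inverse of the canonical map.\<close>

theorem exact_at_middle_iff_im_to_ker:
  assumes f: "f \<in> Hom C L M" and g: "g \<in> Hom C M N" and gf: "g \<odot> f = Zero C L N"
  shows "exact_at_middle C f g \<longleftrightarrow> is_isomorphism C (im_to_ker C f g)"
proof -
  define c m k A K where "c = coker_arr C f" "m = im_arr C f" "k = ker_arr C g"
    "A = Dom C m" "K = Dom C k"
  note defs = this
  have arr: "f \<in> Arr C" "g \<in> Arr C" "Cod C f = Dom C g" using f g by (auto simp: Hom_def)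
  have coker: "is_cokernel C f c" and im: "is_kernel C c m" and ker: "is_kernel C g k"
    unfolding defs using arr coker_arr_is_cokernel im_arr_is_kernel ker_arr_is_kernel by auto
  have c: "c \<in> Hom C M (Cod C c)" using is_cokernel_Hom[OF coker f] .
  have m: "m \<in> Hom C A M" using is_kernel_Hom[OF im c] by (simp add: defs)
  have k: "k \<in> Hom C K M" using is_kernel_Hom[OF ker g] by (simp add: defs)
  have mono: "is_mono C m" "is_mono C k" using im ker kernel_is_mono by auto
  \<comment> \<open>As \<open>g\<close> annihilates \<open>f\<close>, it factors through the
    cokernel \<open>c\<close>; therefore it also annihilates \<open>m\<close>, the kernel of
    \<open>c\<close>.\<close>
  obtain g' where g': "g' \<in> Hom C (Cod C c) N" "g' \<odot> c = g"
    using cokernel_factors[OF coker f g gf] .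
  have "g \<odot> m = Zero C A N"
    using Comp_assoc[OF m c g'(1)] g' is_kernel_Comp[OF im c] Comp_Zero[OF Hom_Obj(1)[OF m] g'(1)]
    by (simp add: defs)
  then obtain u where u: "u \<in> Hom C A K" "k \<odot> u = m"
    using kernel_factors[OF ker g m] by (metis defs(5))
  \<comment> \<open>Monicity of \<open>k\<close> gives the uniqueness that \<open>THE\<close>
    requires.\<close>
  have "im_to_ker C f g = u"
    unfolding im_to_ker_def defs[symmetric]
    using u is_mono_cancel[OF mono(2) k] by (intro the_equality) auto
  moreover have "exact_at_middle C f g \<longleftrightarrow> (\<exists>w \<in> Hom C K A. m \<odot> w = k)"
    using arr mono u m k
    unfolding exact_at_middle_def subobject_le_def defs[symmetric] by (auto simp: Hom_def)
  \<comment> \<open>The inverse laws may be checked after composing with the monic \<open>m\<close>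
    and \<open>k\<close>. Conversely,
    \<open>m \<odot> w = k \<odot> (u \<odot> w) = k\<close>.\<close>
  moreover have "m \<odot> w = k \<longleftrightarrow> w \<odot> u = Ident C A \<and> u \<odot> w = Ident C K" if w: "w \<in> Hom C K A" for w
  proof
    assume mw: "m \<odot> w = k"
    have "m \<odot> (w \<odot> u) = m \<odot> Ident C A"
      using Comp_assoc[OF u(1) w m] mw u m Comp_Ident by simp
    then have "w \<odot> u = Ident C A"
      using is_mono_cancel[OF mono(1) m] u w m Comp_in_Hom Ident_in_Hom Hom_Obj by metis
    moreover have "k \<odot> (u \<odot> w) = k \<odot> Ident C K"
      using Comp_assoc[OF w u(1) k] mw u k Comp_Ident by simp
    then have "u \<odot> w = Ident C K"
      using is_mono_cancel[OF mono(2) k] u w k Comp_in_Hom Ident_in_Hom Hom_Obj by metis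
    ultimately show "w \<odot> u = Ident C A \<and> u \<odot> w = Ident C K" by blast
  next
    assume "w \<odot> u = Ident C A \<and> u \<odot> w = Ident C K"
    then show "m \<odot> w = k" using Comp_assoc[OF w u(1) k] u k Comp_Ident by simp
  qed
  moreover have "u \<in> Arr C" "Dom C u = A" "Cod C u = K" using u by (auto simp: Hom_def)
  ultimately show ?thesis unfolding is_isomorphism_def by auto
qed

end

section \<open>Kernels in functor categories\<close>

lemma functor_category_simps:
  "Obj (functor_category I C) = {F. is_functor I C F}"
  "Arr (functor_category I C) = {t. is_natural I C t}"
  "Dom (functor_category I C) = Source"
  "Cod (functor_category I C) = Target"
  "Ident (functor_category I C) F =
     \<lparr>Source = F, Target = F, Component = (\<lambda>i \<in> Obj I. Ident C (FObj F i))\<rparr>"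
  "t \<odot>\<^bsub>functor_category I C\<^esub> s = \<lparr>Source = Source s, Target = Target t,
     Component = (\<lambda>i \<in> Obj I. Component t i \<odot>\<^bsub>C\<^esub> Component s i)\<rparr>"
  "Zero (functor_category I C) F G =
     \<lparr>Source = F, Target = G, Component = (\<lambda>i \<in> Obj I. Zero C (FObj F i) (FObj G i))\<rparr>"
  by (simp_all add: functor_category_def)

lemma transformation_eqI:
  assumes "Source s = Source t" "Target s = Target t"
    and "Component s \<in> extensional X" "Component t \<in> extensional X"
    and "\<And>i. i \<in> X \<Longrightarrow> Component s i = Component t i"
  shows "s = (t :: ('i, 'j, 'o, 'm) transformation)"
  using assms extensionalityI[of "Component s" X "Component t"] by (cases s, cases t) auto

lemma is_natural_functors:
  assumes "is_natural I C t"
  shows "is_functor I C (Source t)" "is_functor I C (Target t)"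
  using assms unfolding is_natural_def by blast+

lemma is_natural_Component:
  assumes "is_natural I C t" "i \<in> Obj I"
  shows "Component t i \<in> Hom C (FObj (Source t) i) (FObj (Target t) i)"
  using assms unfolding is_natural_def by blast

lemma is_natural_square:
  assumes "is_natural I C t" "a \<in> Hom I i j"
  shows "Component t j \<odot>\<^bsub>C\<^esub> FArr (Source t) a = FArr (Target t) a \<odot>\<^bsub>C\<^esub> Component t i"
  using assms unfolding is_natural_def Hom_def by blast

lemma is_natural_ext: "is_natural I C t \<Longrightarrow> Component t \<in> extensional (Obj I)"
  unfolding is_natural_def PiE_def by blast

lemma is_functor_FObj: "is_functor I C F \<Longrightarrow> i \<in> Obj I \<Longrightarrow> FObj F i \<in> Obj C"
  unfolding is_functor_def by blast

lemma is_functor_FArr: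
  "is_functor I C F \<Longrightarrow> a \<in> Hom I i j \<Longrightarrow> FArr F a \<in> Hom C (FObj F i) (FObj F j)"
  unfolding is_functor_def Hom_def by blast

lemma is_functor_Ident:
  "is_functor I C F \<Longrightarrow> i \<in> Obj I \<Longrightarrow> FArr F (Ident I i) = Ident C (FObj F i)"
  unfolding is_functor_def by blast

lemma is_functor_Comp:
  "is_functor I C F \<Longrightarrow> a \<in> Hom I i j \<Longrightarrow> b \<in> Hom I j l \<Longrightarrow>
    FArr F (b \<odot>\<^bsub>I\<^esub> a) = FArr F b \<odot>\<^bsub>C\<^esub> FArr F a"
  unfolding is_functor_def Hom_def by auto

lemma is_functorI:
  assumes "category I"
    and obj: "\<And>i. i \<in> Obj I \<Longrightarrow> Fo i \<in> Obj C"
    and arr: "\<And>a i j. a \<in> Hom I i j \<Longrightarrow> Fa a \<in> Hom C (Fo i) (Fo j)"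
    and ident: "\<And>i. i \<in> Obj I \<Longrightarrow> Fa (Ident I i) = Ident C (Fo i)"
    and comp: "\<And>a b i j l. a \<in> Hom I i j \<Longrightarrow> b \<in> Hom I j l \<Longrightarrow> Fa (b \<odot>\<^bsub>I\<^esub> a) = Fa b \<odot>\<^bsub>C\<^esub> Fa a"
  shows "is_functor I C \<lparr>FObj = restrict Fo (Obj I), FArr = restrict Fa (Arr I)\<rparr>"
proof -
  interpret I: category I by fact
  have 1: "Fa a \<in> Hom C (Fo (Dom I a)) (Fo (Cod I a))" if "a \<in> Arr I" for a
    using that arr by (simp add: Hom_def)
  have 2: "Fa a \<in> Arr C" if "a \<in> Arr I" for a
    using 1[OF that] by (simp add: Hom_def)
  have 3: "Ident I i \<in> Arr I" if "i \<in> Obj I" for i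
    using I.Ident_in_Hom[OF that] by (simp add: Hom_def)
  have 4: "b \<odot>\<^bsub>I\<^esub> a \<in> Arr I" "Fa (b \<odot>\<^bsub>I\<^esub> a) = Fa b \<odot>\<^bsub>C\<^esub> Fa a"
    if "a \<in> Arr I" "b \<in> Arr I" "Cod I a = Dom I b" for a b
    using I.Comp_in_Hom[of a "Dom I a" "Cod I a" b "Cod I b"]
      comp[of a "Dom I a" "Cod I a" b "Cod I b"] that by (simp_all add: Hom_def)
  show ?thesis
    unfolding is_functor_def using 1 2 3 4 obj ident I.Dom_in_Obj I.Cod_in_Obj by simp
qed

lemma is_naturalI:
  assumes "is_functor I C F" "is_functor I C G"
    and "\<And>i. i \<in> Obj I \<Longrightarrow> T i \<in> Hom C (FObj F i) (FObj G i)"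
    and "\<And>a i j. a \<in> Hom I i j \<Longrightarrow> i \<in> Obj I \<Longrightarrow> j \<in> Obj I \<Longrightarrow> T j \<odot>\<^bsub>C\<^esub> FArr F a = FArr G a \<odot>\<^bsub>C\<^esub> T i"
    and "category I"
  shows "is_natural I C \<lparr>Source = F, Target = G, Component = (\<lambda>i \<in> Obj I. T i)\<rparr>"
proof -
  interpret I: category I by fact
  show ?thesis
    unfolding is_natural_def
  proof (intro conjI ballI)
    fix a assume "a \<in> Arr I"
    then show "Component \<lparr>Source = F, Target = G, Component = restrict T (Obj I)\<rparr> (Cod I a) \<odot>\<^bsub>C\<^esub>
        FArr (Source \<lparr>Source = F, Target = G, Component = restrict T (Obj I)\<rparr>) a =
      FArr (Target \<lparr>Source = F, Target = G, Component = restrict T (Obj I)\<rparr>) a \<odot>\<^bsub>C\<^esub>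
        Component \<lparr>Source = F, Target = G, Component = restrict T (Obj I)\<rparr> (Dom I a)"
      using assms(4)[of a "Dom I a" "Cod I a"] I.Dom_in_Obj I.Cod_in_Obj by (simp add: Hom_def)
  qed (use assms(1-3) in \<open>auto simp: Hom_def\<close>)
qed

text \<open>Only zero arrows are assumed, so passing to \<open>opposite I\<close> and
  \<open>opposite_ab C\<close> stays within the setting; existence of kernels is a premise of the
  individual results.\<close>

locale functor_setting = I: category I + C: zero_category C
  for I :: "('i, 'j, 'x) category_scheme" and C :: "('o, 'm, 'y) ab_category_scheme" (structure)
begin

abbreviation "F \<equiv> functor_category I C"

lemma Hom_functor_category: "t \<in> Hom F S T \<longleftrightarrow> is_natural I C t \<and> Source t = S \<and> Target t = T"
  by (simp add: Hom_def functor_category_simps)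

lemma Component_Hom:
  "t \<in> Hom F S T \<Longrightarrow> i \<in> Obj I \<Longrightarrow> Component t i \<in> Hom C (FObj S i) (FObj T i)"
  unfolding Hom_functor_category using is_natural_Component by auto

lemma naturality:
  "t \<in> Hom F S T \<Longrightarrow> a \<in> Hom I i j \<Longrightarrow> Component t j \<odot> FArr S a = FArr T a \<odot> Component t i"
  unfolding Hom_functor_category using is_natural_square by auto

lemma Hom_is_functor:
  assumes "t \<in> Hom F S T"
  shows "is_functor I C S" "is_functor I C T"
  using assms is_natural_functors unfolding Hom_functor_category by blast+

lemma Component_Comp: "i \<in> Obj I \<Longrightarrow> Component (t \<odot>\<^bsub>F\<^esub> s) i = Component t i \<odot> Component s i"
  by (simp add: functor_category_simps)

lemma Component_Zero: "i \<in> Obj I \<Longrightarrow> Component (Zero F S T) i = Zero C (FObj S i) (FObj T i)"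
  by (simp add: functor_category_simps)

lemma Component_Ident: "i \<in> Obj I \<Longrightarrow> Component (Ident F S) i = Ident C (FObj S i)"
  by (simp add: functor_category_simps)

lemma Hom_eqI:
  assumes "s \<in> Hom F S T" "t \<in> Hom F S T" "\<And>i. i \<in> Obj I \<Longrightarrow> Component s i = Component t i"
  shows "s = t"
  using assms is_natural_ext unfolding Hom_functor_category
  by (intro transformation_eqI[where X = "Obj I"]) auto

text \<open>The equations hold in each component and lift by extensionality. Naturality of a
  composite is the pasting of two squares; in the square of a zero transformation both composites
  are zero arrows. The preceding theory of kernels thus becomes available for functors.\<close>

sublocale functor_category: zero_category F
proof (intro zero_category.intro category.intro zero_category_axioms.intro)
  fix t assume "t \<in> Arr F"
  then show "Dom F t \<in> Obj F" "Cod F t \<in> Obj F"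
    by (simp_all add: functor_category_simps is_natural_functors)
next
  fix S assume "S \<in> Obj F"
  then have S: "is_functor I C S" by (simp add: functor_category_simps)
  show "Ident F S \<in> Hom F S S"
    unfolding Hom_functor_category functor_category_simps
  proof (intro conjI, rule is_naturalI)
    fix a i j assume a: "a \<in> Hom I i j"
    show "Ident C (FObj S j) \<odot> FArr S a = FArr S a \<odot> Ident C (FObj S i)"
      using C.Ident_Comp[OF is_functor_FArr[OF S a]] C.Comp_Ident[OF is_functor_FArr[OF S a]] by simp
  qed (use S is_functor_FObj[OF S] C.Ident_in_Hom I.category_axioms in auto)
next
  fix s t S T U assume s: "s \<in> Hom F S T" and t: "t \<in> Hom F T U"
  note * = s t s[unfolded Hom_functor_category] t[unfolded Hom_functor_category]
  show "t \<odot>\<^bsub>F\<^esub> s \<in> Hom F S U"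
    unfolding Hom_functor_category functor_category_simps
  proof (intro conjI, rule is_naturalI)
    show "is_functor I C (Source s)" "is_functor I C (Target t)"
      using * by (auto simp: is_natural_functors)
    show "Component t i \<odot> Component s i \<in> Hom C (FObj (Source s) i) (FObj (Target t) i)"
      if "i \<in> Obj I" for i
      using * is_natural_Component that C.Comp_in_Hom by metis
    fix a i j assume a: "a \<in> Hom I i j" and i: "i \<in> Obj I" and j: "j \<in> Obj I"
    have sc: "Component s l \<in> Hom C (FObj S l) (FObj T l)"
      and tc: "Component t l \<in> Hom C (FObj T l) (FObj U l)" if "l \<in> Obj I" for l
      using * is_natural_Component that by metis+
    have Sa: "FArr S a \<in> Hom C (FObj S i) (FObj S j)" and Ta: "FArr T a \<in> Hom C (FObj T i) (FObj T j)"
      and Ua: "FArr U a \<in> Hom C (FObj U i) (FObj U j)"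
      using * a is_functor_FArr by (metis is_natural_functors)+
    have "(Component t j \<odot> Component s j) \<odot> FArr S a = Component t j \<odot> (FArr T a \<odot> Component s i)"
      using C.Comp_assoc[OF Sa sc[OF j] tc[OF j]] is_natural_square[OF _ a] * by metis
    also have "\<dots> = (FArr U a \<odot> Component t i) \<odot> Component s i"
      using C.Comp_assoc[OF sc[OF i] Ta tc[OF j]] is_natural_square[OF _ a] * by metis
    also have "\<dots> = FArr U a \<odot> (Component t i \<odot> Component s i)"
      using C.Comp_assoc[OF sc[OF i] tc[OF i] Ua] .
    finally show "(Component t j \<odot> Component s j) \<odot> FArr (Source s) a =
        FArr (Target t) a \<odot> (Component t i \<odot> Component s i)"
      using * by simp
  qed (use * I.category_axioms in auto)
next
  fix s S T assume s: "s \<in> Hom F S T"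
  then have s': "Source s = S" "Target s = T" "Component s \<in> extensional (Obj I)"
    unfolding Hom_functor_category using is_natural_ext by blast+
  show "s \<odot>\<^bsub>F\<^esub> Ident F S = s" "Ident F T \<odot>\<^bsub>F\<^esub> s = s"
    by (rule transformation_eqI[where X = "Obj I"];
        use s' C.Comp_Ident[OF Component_Hom[OF s]] C.Ident_Comp[OF Component_Hom[OF s]]
        in \<open>simp add: functor_category_simps\<close>)+
next
  fix s t r S T U V assume "s \<in> Hom F S T" "t \<in> Hom F T U" "r \<in> Hom F U V"
  note 1 = this[THEN Component_Hom]
  show "(r \<odot>\<^bsub>F\<^esub> t) \<odot>\<^bsub>F\<^esub> s = r \<odot>\<^bsub>F\<^esub> (t \<odot>\<^bsub>F\<^esub> s)"
    by (rule transformation_eqI[where X = "Obj I"])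
       (use C.Comp_assoc[OF 1] in \<open>simp_all add: functor_category_simps\<close>)
next
  fix S T assume "S \<in> Obj F" "T \<in> Obj F"
  then have S: "is_functor I C S" and T: "is_functor I C T" by (simp_all add: functor_category_simps)
  show "Zero F S T \<in> Hom F S T"
    unfolding Hom_functor_category functor_category_simps
  proof (intro conjI, rule is_naturalI)
    fix a i j assume a: "a \<in> Hom I i j" and i: "i \<in> Obj I" and j: "j \<in> Obj I"
    show "Zero C (FObj S j) (FObj T j) \<odot> FArr S a = FArr T a \<odot> Zero C (FObj S i) (FObj T i)"
      using C.Zero_Comp[OF is_functor_FArr[OF S a] is_functor_FObj[OF T j]]
        C.Comp_Zero[OF is_functor_FObj[OF S i] is_functor_FArr[OF T a]] by simp
  qed (use S T is_functor_FObj[OF S] is_functor_FObj[OF T] C.Zero_in_Hom I.category_axioms in auto)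
next
  fix s S T U assume S: "S \<in> Obj F" and s: "s \<in> Hom F T U"
  have "is_functor I C S" using S by (simp add: functor_category_simps)
  note 1 = is_functor_FObj[OF this]
  show "s \<odot>\<^bsub>F\<^esub> Zero F S T = Zero F S U"
    by (rule transformation_eqI[where X = "Obj I"])
       (use C.Comp_Zero[OF 1 Component_Hom[OF s]] s in
         \<open>simp_all add: functor_category_simps Hom_functor_category\<close>)
next
  fix s S T U assume s: "s \<in> Hom F S T" and U: "U \<in> Obj F"
  have "is_functor I C U" using U by (simp add: functor_category_simps)
  note 1 = is_functor_FObj[OF this]
  show "Zero F T U \<odot>\<^bsub>F\<^esub> s = Zero F S U"
    by (rule transformation_eqI[where X = "Obj I"])
       (use C.Zero_Comp[OF Component_Hom[OF s] 1] s in
         \<open>simp_all add: functor_category_simps Hom_functor_category\<close>)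
qed

section \<open>Pointwise computation of kernels\<close>

lemma pointwise_kernel:
  assumes t: "t \<in> Hom F M N" and k: "k \<in> Hom F K M"
    and ker: "\<And>i. i \<in> Obj I \<Longrightarrow> is_kernel C (Component t i) (Component k i)"
  shows "is_kernel F t k"
proof -
  note tc = Component_Hom[OF t] and kc = Component_Hom[OF k]
  have ker_zero: "Component t i \<odot> Component k i = Zero C (FObj K i) (FObj N i)" if i: "i \<in> Obj I" for i
    using ker[OF i] unfolding C.is_kernel_iff[OF tc[OF i] kc[OF i]] by (rule conjunct1)
  have mono: "u = v" if "i \<in> Obj I" "u \<in> Hom C A (FObj K i)" "v \<in> Hom C A (FObj K i)"
    "Component k i \<odot> u = Component k i \<odot> v" for u v A i
    using C.is_mono_cancel[OF C.kernel_is_mono[OF ker[OF that(1)]] kc[OF that(1)] that(2-4)] .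
  show ?thesis unfolding functor_category.is_kernel_iff[OF t k]
  proof (intro conjI allI ballI impI)
    show "t \<odot>\<^bsub>F\<^esub> k = Zero F K N"
    proof (rule Hom_eqI)
      show "t \<odot>\<^bsub>F\<^esub> k \<in> Hom F K N" using functor_category.Comp_in_Hom[OF k t] .
      show "Zero F K N \<in> Hom F K N"
        using functor_category.Zero_in_Hom functor_category.Hom_Obj t k by blast
    qed (simp add: Component_Comp Component_Zero ker_zero)
    fix H h assume h: "h \<in> Hom F H M" and th: "t \<odot>\<^bsub>F\<^esub> h = Zero F H N"
    note hc = Component_Hom[OF h]
    have "\<exists>u. u \<in> Hom C (FObj H i) (FObj K i) \<and> Component k i \<odot> u = Component h i"
      if i: "i \<in> Obj I" for i
    proof -
      have "Component t i \<odot> Component h i = Zero C (FObj H i) (FObj N i)"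
        using arg_cong[OF th, of "\<lambda>x. Component x i"] i by (simp add: Component_Comp Component_Zero)
      then obtain u where "u \<in> Hom C (FObj H i) (Dom C (Component k i))"
        "Component k i \<odot> u = Component h i"
        using C.kernel_factors[OF ker[OF i] tc[OF i] hc[OF i]] by blast
      then show ?thesis using kc[OF i] by (auto simp: Hom_def)
    qed
    then obtain U where U: "\<And>i. i \<in> Obj I \<Longrightarrow> U i \<in> Hom C (FObj H i) (FObj K i)"
      and kU: "\<And>i. i \<in> Obj I \<Longrightarrow> Component k i \<odot> U i = Component h i"
      by metis
    define u where "u = \<lparr>Source = H, Target = K, Component = (\<lambda>i \<in> Obj I. U i)\<rparr>"
    have "is_natural I C u"
      unfolding u_def
    proof (rule is_naturalI)
      show H: "is_functor I C H" and K: "is_functor I C K" using Hom_is_functor h k by blast+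
      have M: "is_functor I C M" using Hom_is_functor h by blast
      fix a i j assume a: "a \<in> Hom I i j" and i: "i \<in> Obj I" and j: "j \<in> Obj I"
      note Ha = is_functor_FArr[OF H a] and Ka = is_functor_FArr[OF K a]
        and Ma = is_functor_FArr[OF M a]
      \<comment> \<open>The square for \<open>U\<close> is tested after composing with
        \<open>Component k j\<close>, where it reduces to the squares of \<open>h\<close> and
        \<open>k\<close>.\<close>
      have "Component k j \<odot> (U j \<odot> FArr H a) = Component h j \<odot> FArr H a"
        using C.Comp_assoc[OF Ha U[OF j] kc[OF j]] kU[OF j] by simp
      also have "\<dots> = FArr M a \<odot> (Component k i \<odot> U i)"
        using naturality[OF h a] kU[OF i] by simp
      also have "\<dots> = (Component k j \<odot> FArr K a) \<odot> U i"
        using C.Comp_assoc[OF U[OF i] kc[OF i] Ma] naturality[OF k a] by simp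
      also have "\<dots> = Component k j \<odot> (FArr K a \<odot> U i)"
        using C.Comp_assoc[OF U[OF i] Ka kc[OF j]] .
      finally show "U j \<odot> FArr H a = FArr K a \<odot> U i"
        using mono[OF j C.Comp_in_Hom[OF Ha U[OF j]] C.Comp_in_Hom[OF U[OF i] Ka]] by blast
    qed (use U I.category_axioms in auto)
    then have u: "u \<in> Hom F H K" unfolding Hom_functor_category by (simp add: u_def)
    have ku: "k \<odot>\<^bsub>F\<^esub> u = h"
      using functor_category.Comp_in_Hom[OF u k] h
      by (rule Hom_eqI) (simp add: Component_Comp kU, simp add: u_def kU)
    have unique: "v = u" if v: "v \<in> Hom F H K" "k \<odot>\<^bsub>F\<^esub> v = h" for v
    proof (rule Hom_eqI[OF v(1) u])
      fix i assume i: "i \<in> Obj I"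
      have "Component k i \<odot> Component v i = Component k i \<odot> Component u i"
        using arg_cong[OF v(2), of "\<lambda>x. Component x i"] i kU by (simp add: Component_Comp u_def)
      then show "Component v i = Component u i"
        using mono[OF i Component_Hom[OF v(1) i] Component_Hom[OF u i]] by blast
    qed
    show "\<exists>!u. u \<in> Hom F H K \<and> k \<odot>\<^bsub>F\<^esub> u = h"
    proof (rule ex1I)
      show "u \<in> Hom F H K \<and> k \<odot>\<^bsub>F\<^esub> u = h" using u ku by (rule conjI)
    qed (use unique in blast)
  qed
qed

text \<open>A kernel \<open>\<kappa> i\<close> is chosen at each object \<open>i\<close>. For
  \<open>a\<close> from \<open>i\<close> to \<open>j\<close>, the arrow between the kernel objects
  is the factorisation of \<open>FArr M a \<odot> \<kappa> i\<close> through
  \<open>\<kappa> j\<close>; its defining equation is at the same time the naturality of the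
  inclusion into \<open>M\<close>.\<close>

lemma ex_pointwise_kernel:
  assumes t: "t \<in> Hom F M N" and ex: "\<And>i. i \<in> Obj I \<Longrightarrow> \<exists>k. is_kernel C (Component t i) k"
  obtains K k where "k \<in> Hom F K M"
    "\<And>i. i \<in> Obj I \<Longrightarrow> is_kernel C (Component t i) (Component k i)"
proof -
  note tc = Component_Hom[OF t]
  have M: "is_functor I C M" and N: "is_functor I C N" using Hom_is_functor[OF t] by auto
  obtain \<kappa> where ker: "\<And>i. i \<in> Obj I \<Longrightarrow> is_kernel C (Component t i) (\<kappa> i)"
    using ex by metis
  define Ko where "Ko i = Dom C (\<kappa> i)" for i
  have \<kappa>: "\<kappa> i \<in> Hom C (Ko i) (FObj M i)" if "i \<in> Obj I" for i
    using C.is_kernel_Hom[OF ker tc] that unfolding Ko_def by blast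
  have mono: "u = v" if "i \<in> Obj I" "u \<in> Hom C A (Ko i)" "v \<in> Hom C A (Ko i)"
    "\<kappa> i \<odot> u = \<kappa> i \<odot> v" for u v A i
    using C.is_mono_cancel[OF C.kernel_is_mono[OF ker[OF that(1)]] \<kappa>[OF that(1)] that(2-4)] .
  have "\<exists>u. u \<in> Hom C (Ko (Dom I a)) (Ko (Cod I a)) \<and> \<kappa> (Cod I a) \<odot> u = FArr M a \<odot> \<kappa> (Dom I a)"
    if "a \<in> Arr I" for a
  proof -
    define i j where "i = Dom I a" "j = Cod I a"
    have i: "i \<in> Obj I" and j: "j \<in> Obj I" and a: "a \<in> Hom I i j"
      using that I.Dom_in_Obj I.Cod_in_Obj by (simp_all add: i_j_def Hom_def)
    note Ma = is_functor_FArr[OF M a] and Na = is_functor_FArr[OF N a]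
    \<comment> \<open>Naturality of \<open>t\<close> replaces \<open>Component t j\<close> by
      \<open>Component t i\<close>, which annihilates \<open>\<kappa> i\<close>.\<close>
    have "Component t j \<odot> (FArr M a \<odot> \<kappa> i) = (FArr N a \<odot> Component t i) \<odot> \<kappa> i"
      using C.Comp_assoc[OF \<kappa>[OF i] Ma tc[OF j]] naturality[OF t a] by simp
    also have "\<dots> = FArr N a \<odot> Zero C (Ko i) (FObj N i)"
      using C.Comp_assoc[OF \<kappa>[OF i] tc[OF i] Na] C.is_kernel_Comp[OF ker[OF i] tc[OF i]]
      by (simp add: Ko_def)
    also have "\<dots> = Zero C (Ko i) (FObj N j)"
      using C.Comp_Zero[OF C.Hom_Obj(1)[OF \<kappa>[OF i]] Na] .
    finally obtain u where "u \<in> Hom C (Ko i) (Dom C (\<kappa> j))" "\<kappa> j \<odot> u = FArr M a \<odot> \<kappa> i"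
      using C.kernel_factors[OF ker[OF j] tc[OF j] C.Comp_in_Hom[OF \<kappa>[OF i] Ma]] by blast
    then show ?thesis unfolding Ko_def i_j_def by blast
  qed
  then obtain \<phi> where \<phi>: "\<And>a. a \<in> Arr I \<Longrightarrow> \<phi> a \<in> Hom C (Ko (Dom I a)) (Ko (Cod I a)) \<and>
      \<kappa> (Cod I a) \<odot> \<phi> a = FArr M a \<odot> \<kappa> (Dom I a)"
    by metis
  have \<phi>_Hom: "\<phi> a \<in> Hom C (Ko i) (Ko j)" and \<phi>_nat: "\<kappa> j \<odot> \<phi> a = FArr M a \<odot> \<kappa> i"
    if "a \<in> Hom I i j" for a i j
    using \<phi>[of a] that by (simp_all add: Hom_def)
  define K where "K = \<lparr>FObj = restrict Ko (Obj I), FArr = restrict \<phi> (Arr I)\<rparr>"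
  have K: "is_functor I C K"
    unfolding K_def
  proof (rule is_functorI)
    fix i assume i: "i \<in> Obj I"
    show Ko: "Ko i \<in> Obj C" using C.Hom_Obj(1)[OF \<kappa>[OF i]] .
    \<comment> \<open>The functor laws are compared after composing with the monic
      \<open>\<kappa>\<close>; this makes the separately chosen \<open>\<phi> a\<close>
      compatible.\<close>
    have "\<kappa> i \<odot> \<phi> (Ident I i) = \<kappa> i \<odot> Ident C (Ko i)"
      using \<phi>_nat[OF I.Ident_in_Hom[OF i]] is_functor_Ident[OF M i]
        C.Ident_Comp[OF \<kappa>[OF i]] C.Comp_Ident[OF \<kappa>[OF i]] by simp
    then show "\<phi> (Ident I i) = Ident C (Ko i)"
      using mono[OF i \<phi>_Hom[OF I.Ident_in_Hom[OF i]] C.Ident_in_Hom[OF Ko]] by blast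
  next
    fix a b i j l assume a: "a \<in> Hom I i j" and b: "b \<in> Hom I j l"
    have i: "i \<in> Obj I" and j: "j \<in> Obj I" and l: "l \<in> Obj I"
      using a b I.Hom_Obj by blast+
    note ba = I.Comp_in_Hom[OF a b]
    note Ma = is_functor_FArr[OF M a] and Mb = is_functor_FArr[OF M b]
    have "\<kappa> l \<odot> \<phi> (b \<odot>\<^bsub>I\<^esub> a) = (FArr M b \<odot> FArr M a) \<odot> \<kappa> i"
      using \<phi>_nat[OF ba] is_functor_Comp[OF M a b] by simp
    also have "\<dots> = FArr M b \<odot> (\<kappa> j \<odot> \<phi> a)"
      using C.Comp_assoc[OF \<kappa>[OF i] Ma Mb] \<phi>_nat[OF a] by simp
    also have "\<dots> = (\<kappa> l \<odot> \<phi> b) \<odot> \<phi> a"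
      using C.Comp_assoc[OF \<phi>_Hom[OF a] \<kappa>[OF j] Mb] \<phi>_nat[OF b] by simp
    also have "\<dots> = \<kappa> l \<odot> (\<phi> b \<odot> \<phi> a)"
      using C.Comp_assoc[OF \<phi>_Hom[OF a] \<phi>_Hom[OF b] \<kappa>[OF l]] .
    finally show "\<phi> (b \<odot>\<^bsub>I\<^esub> a) = \<phi> b \<odot> \<phi> a"
      using mono[OF l \<phi>_Hom[OF ba] C.Comp_in_Hom[OF \<phi>_Hom[OF a] \<phi>_Hom[OF b]]] by blast
  qed (use \<phi>_Hom I.category_axioms in auto)
  define k where "k = \<lparr>Source = K, Target = M, Component = (\<lambda>i \<in> Obj I. \<kappa> i)\<rparr>"
  have "is_natural I C k"
    unfolding k_def
  proof (rule is_naturalI)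
    show "\<kappa> i \<in> Hom C (FObj K i) (FObj M i)" if "i \<in> Obj I" for i
      using \<kappa>[OF that] that by (simp add: K_def)
    show "\<kappa> j \<odot> FArr K a = FArr M a \<odot> \<kappa> i" if "a \<in> Hom I i j" for a i j
    proof -
      have "a \<in> Arr I" using that by (simp add: Hom_def)
      then show ?thesis using \<phi>_nat[OF that] by (simp add: K_def)
    qed
  qed (use K M I.category_axioms in auto)
  then have "k \<in> Hom F K M" unfolding Hom_functor_category by (simp add: k_def)
  moreover have "is_kernel C (Component t i) (Component k i)" if "i \<in> Obj I" for i
    using ker[OF that] that by (simp add: k_def)
  ultimately show thesis using that by blast
qed

text \<open>For the forward direction, \<open>ex\<close> yields a kernel \<open>k'\<close> with
  pointwise kernels as components. Then \<open>k\<close> is \<open>k'\<close> composed with an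
  isomorphism of functors, whose components are isomorphisms in \<open>C\<close>, and
  \<open>kernel_comp_iso\<close> applies at each object.\<close>

theorem is_kernel_pointwise_iff:
  assumes t: "t \<in> Hom F M N" and k: "k \<in> Hom F K M"
    and ex: "\<And>i. i \<in> Obj I \<Longrightarrow> \<exists>k. is_kernel C (Component t i) k"
  shows "is_kernel F t k \<longleftrightarrow> (\<forall>i \<in> Obj I. is_kernel C (Component t i) (Component k i))"
proof (intro iffI ballI)
  fix i assume ker: "is_kernel F t k" and i: "i \<in> Obj I"
  obtain K' k' where k': "k' \<in> Hom F K' M"
    and ker': "\<And>i. i \<in> Obj I \<Longrightarrow> is_kernel C (Component t i) (Component k' i)"
    using ex_pointwise_kernel[OF t ex] by blast
  have "Dom F k = K" "Dom F k' = K'" using k k' by (simp_all add: Hom_def)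
  then obtain w w' where w: "w \<in> Hom F K K'" "w' \<in> Hom F K' K" "k' \<odot>\<^bsub>F\<^esub> w = k"
    "w' \<odot>\<^bsub>F\<^esub> w = Ident F K" "w \<odot>\<^bsub>F\<^esub> w' = Ident F K'"
    using functor_category.kernels_iso[OF ker pointwise_kernel[OF t k' ker']] by metis
  have eqs: "Component k' i \<odot> Component w i = Component k i"
    "Component w' i \<odot> Component w i = Ident C (FObj K i)"
    "Component w i \<odot> Component w' i = Ident C (FObj K' i)"
    using w(3-5)[THEN arg_cong[of _ _ "\<lambda>x. Component x i"]] i
    by (simp_all add: Component_Comp Component_Ident)
  show "is_kernel C (Component t i) (Component k i)"
    using C.kernel_comp_iso[OF ker'[OF i] Component_Hom[OF k' i] Component_Hom[OF w(1) i]
        Component_Hom[OF w(2) i] eqs(2,3)] eqs(1) by simp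
qed (use pointwise_kernel[OF t k] in blast)

end

section \<open>Duality\<close>

definition opposite :: "('o, 'm, 'x) category_scheme \<Rightarrow> ('o, 'm, 'x) category_scheme"
  where "opposite C = C\<lparr>Dom := Cod C, Cod := Dom C, Comp := \<lambda>g f. f \<odot>\<^bsub>C\<^esub> g\<rparr>"

text \<open>The index category has no additive fields, hence a separate version for
  \<open>C\<close>. \<open>Zero\<close> takes its objects as arguments and must be reversed;
  \<open>Plus\<close> stays, the hom-groups being the same.\<close>

definition opposite_ab :: "('o, 'm, 'x) ab_category_scheme \<Rightarrow> ('o, 'm, 'x) ab_category_scheme"
  where "opposite_ab C = (opposite C)\<lparr>Zero := \<lambda>A B. Zero C B A\<rparr>"

lemma opposite_simps [simp]:
  "Obj (opposite C) = Obj C" "Arr (opposite C) = Arr C" "Dom (opposite C) = Cod C"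
  "Cod (opposite C) = Dom C" "Ident (opposite C) = Ident C" "g \<odot>\<^bsub>opposite C\<^esub> f = f \<odot>\<^bsub>C\<^esub> g"
  "Hom (opposite C) A B = Hom C B A"
  by (auto simp: opposite_def Hom_def)

lemma opposite_ab_simps [simp]:
  "Obj (opposite_ab C) = Obj C" "Arr (opposite_ab C) = Arr C" "Dom (opposite_ab C) = Cod C"
  "Cod (opposite_ab C) = Dom C" "Ident (opposite_ab C) = Ident C"
  "g \<odot>\<^bsub>opposite_ab C\<^esub> f = f \<odot>\<^bsub>C\<^esub> g" "Hom (opposite_ab C) A B = Hom C B A"
  "Zero (opposite_ab C) A B = Zero C B A"
  by (auto simp: opposite_ab_def opposite_def Hom_def)

lemma (in category) category_opposite: "category (opposite C)"
  by unfold_locales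
    (simp_all add: Dom_in_Obj Cod_in_Obj Ident_in_Hom Comp_in_Hom Comp_Ident Ident_Comp Comp_assoc)

lemma (in zero_category) zero_category_opposite: "zero_category (opposite_ab C)"
  by unfold_locales
    (simp_all add: Dom_in_Obj Cod_in_Obj Ident_in_Hom Comp_in_Hom Comp_Ident Ident_Comp Comp_assoc
      Zero_in_Hom Comp_Zero Zero_Comp)

lemma is_kernel_opposite_iff: "is_kernel (opposite_ab C) f c \<longleftrightarrow> is_cokernel C f c"
  unfolding is_kernel_def is_cokernel_def opposite_ab_simps ..

text \<open>The components of a transformation are already arrows in the right hom-sets of the
  opposite category, so only the stored source and target are exchanged. As an involution,
  \<open>flip\<close> is bijective.\<close>

definition flip :: "('i, 'j, 'o, 'm) transformation \<Rightarrow> ('i, 'j, 'o, 'm) transformation"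
  where "flip t = \<lparr>Source = Target t, Target = Source t, Component = Component t\<rparr>"

lemma flip_simps [simp]:
  "Source (flip t) = Target t" "Target (flip t) = Source t" "Component (flip t) = Component t"
  "flip (flip t) = t"
  by (simp_all add: flip_def)

lemma flip_eq_iff [simp]: "flip s = flip t \<longleftrightarrow> s = t"
  using flip_simps(4) by metis

lemma ex1_flip_iff: "(\<exists>!t. P (flip t)) \<longleftrightarrow> (\<exists>!t. P t)"
  unfolding Ex1_def using flip_simps(4) by metis

lemma is_functor_opposite_iff:
  "is_functor (opposite I) (opposite_ab C) S \<longleftrightarrow> is_functor I C S"
  unfolding is_functor_def opposite_simps opposite_ab_simps by (intro conj_cong refl) metis

text \<open>The square of \<open>flip t\<close> is that of \<open>t\<close> with its two composites
  exchanged, hence the use of \<open>sym\<close>.\<close>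

lemma is_natural_flip_iff:
  "is_natural (opposite I) (opposite_ab C) (flip t) \<longleftrightarrow> is_natural I C t"
  unfolding is_natural_def is_functor_opposite_iff opposite_simps opposite_ab_simps flip_simps
  by (intro iffI; elim conjE; intro conjI ballI)
    (assumption | erule (1) bspec | rule sym, erule (1) bspec)+

context functor_setting
begin

abbreviation "F' \<equiv> functor_category (opposite I) (opposite_ab C)"

lemma functor_setting_opposite: "functor_setting (opposite I) (opposite_ab C)"
  using I.category_opposite C.zero_category_opposite by (rule functor_setting.intro)

lemma flip_Hom_iff: "flip t \<in> Hom F' S T \<longleftrightarrow> t \<in> Hom F T S"
  unfolding Hom_functor_category functor_setting.Hom_functor_category[OF functor_setting_opposite]
    is_natural_flip_iff flip_simps by blast

lemma Hom_opposite: "Hom F' S T = flip ` Hom F T S"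
proof (intro equalityI subsetI)
  fix t assume "t \<in> Hom F' S T"
  then show "t \<in> flip ` Hom F T S"
    using flip_Hom_iff[of "flip t"] by (intro image_eqI[of _ _ "flip t"]) simp_all
qed (use flip_Hom_iff in blast)

lemma flip_Comp: "flip s \<odot>\<^bsub>F'\<^esub> flip t = flip (t \<odot>\<^bsub>F\<^esub> s)"
  by (simp add: functor_category_simps flip_def)

lemma flip_Zero: "Zero F' S T = flip (Zero F T S)"
  by (simp add: functor_category_simps flip_def)

text \<open>On arrows, \<open>flip\<close> is an isomorphism from the opposite of \<open>F\<close>
  to \<open>F'\<close>, respecting composition and zero arrows, and kernels in the opposite of
  \<open>F\<close> are cokernels in \<open>F\<close>.\<close>

lemma is_kernel_flip_iff:
  assumes t: "t \<in> Hom F L M" and c: "c \<in> Hom F M Q"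
  shows "is_kernel F' (flip t) (flip c) \<longleftrightarrow> is_cokernel F t c"
proof -
  interpret F_op: zero_category "opposite_ab F"
    by (rule functor_category.zero_category_opposite)
  interpret F': functor_setting "opposite I" "opposite_ab C"
    by (rule functor_setting_opposite)
  \<comment> \<open>\<open>X\<close> stands for a hom-set of \<open>F\<close>, whose image under
    \<open>flip\<close> is the corresponding hom-set of \<open>F'\<close>; unique factorisations are
    carried across this bijection.\<close>
  have ex1: "(\<exists>!u. u \<in> flip ` X \<and> flip c \<odot>\<^bsub>F'\<^esub> u = flip h) \<longleftrightarrow> (\<exists>!u. u \<in> X \<and> u \<odot>\<^bsub>F\<^esub> c = h)" for X h
  proof -
    have "u \<in> flip ` X \<and> flip c \<odot>\<^bsub>F'\<^esub> u = flip h \<longleftrightarrow> flip u \<in> X \<and> flip u \<odot>\<^bsub>F\<^esub> c = h" for u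
    proof -
      have "u \<in> flip ` X \<longleftrightarrow> flip u \<in> X" by (metis flip_simps(4) imageE imageI)
      moreover have "flip c \<odot>\<^bsub>F'\<^esub> u = flip (flip u \<odot>\<^bsub>F\<^esub> c)" using flip_Comp[of c "flip u"] by simp
      ultimately show ?thesis by simp
    qed
    then show ?thesis
      using ex1_flip_iff[of "\<lambda>u. u \<in> X \<and> u \<odot>\<^bsub>F\<^esub> c = h"] by simp
  qed
  have "is_kernel F' (flip t) (flip c) \<longleftrightarrow> flip t \<odot>\<^bsub>F'\<^esub> flip c = Zero F' Q L \<and>
      (\<forall>A. \<forall>h \<in> Hom F' A M. flip t \<odot>\<^bsub>F'\<^esub> h = Zero F' A L \<longrightarrow>
        (\<exists>!u. u \<in> Hom F' A Q \<and> flip c \<odot>\<^bsub>F'\<^esub> u = h))"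
    by (rule F'.functor_category.is_kernel_iff) (simp_all add: flip_Hom_iff t c)
  also have "\<dots> \<longleftrightarrow> c \<odot>\<^bsub>F\<^esub> t = Zero F L Q \<and>
      (\<forall>A. \<forall>h \<in> Hom F M A. h \<odot>\<^bsub>F\<^esub> t = Zero F L A \<longrightarrow> (\<exists>!u. u \<in> Hom F Q A \<and> u \<odot>\<^bsub>F\<^esub> c = h))"
    by (simp only: Hom_opposite ball_simps flip_Comp flip_Zero flip_eq_iff ex1)
  also have "\<dots> \<longleftrightarrow> is_kernel (opposite_ab F) t c"
    using F_op.is_kernel_iff[of t M L c Q] t c by (simp only: opposite_ab_simps)
  finally show ?thesis by (simp only: is_kernel_opposite_iff)
qed

text \<open>This is the result on kernels for the opposite categories, read back through
  \<open>flip\<close>.\<close>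

theorem is_cokernel_pointwise_iff:
  assumes t: "t \<in> Hom F L M" and c: "c \<in> Hom F M Q"
    and ex: "\<And>i. i \<in> Obj I \<Longrightarrow> \<exists>c. is_cokernel C (Component t i) c"
  shows "is_cokernel F t c \<longleftrightarrow> (\<forall>i \<in> Obj I. is_cokernel C (Component t i) (Component c i))"
proof -
  interpret F': functor_setting "opposite I" "opposite_ab C"
    by (rule functor_setting_opposite)
  have "is_kernel F' (flip t) (flip c) \<longleftrightarrow>
    (\<forall>i \<in> Obj (opposite I). is_kernel (opposite_ab C) (Component (flip t) i) (Component (flip c) i))"
    using t c ex by (intro F'.is_kernel_pointwise_iff[where M = M and N = L and K = Q])
      (simp_all add: flip_Hom_iff is_kernel_opposite_iff)
  then show ?thesis
    by (simp add: is_kernel_flip_iff[OF t c] is_kernel_opposite_iff)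
qed

end

section \<open>Exactness in the functor category\<close>

locale kernel_cokernel_functor_setting = I: category I + C: kernel_cokernel_category C
  for I :: "('i, 'j, 'x) category_scheme" and C :: "('o, 'm, 'y) ab_category_scheme" (structure)
begin

sublocale functor_setting I C ..

lemma Component_Arr: "t \<in> Hom F S T \<Longrightarrow> i \<in> Obj I \<Longrightarrow> Component t i \<in> Arr C"
  using Component_Hom unfolding Hom_def by blast

text \<open>Pointwise kernels assemble to kernels of transformations. Cokernels arise by the same
  construction in \<open>F'\<close>, applied to \<open>flip t\<close>.\<close>

sublocale functor_category: kernel_cokernel_category F
proof
  fix t assume "t \<in> Arr F"
  then obtain M N where t: "t \<in> Hom F M N" unfolding Hom_self_iff[symmetric] ..
  obtain K k where "k \<in> Hom F K M"
    and "\<And>i. i \<in> Obj I \<Longrightarrow> is_kernel C (Component t i) (Component k i)"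
    using ex_pointwise_kernel[OF t C.ex_kernel[OF Component_Arr[OF t]]] by blast
  then show "\<exists>k. is_kernel F t k"
    using pointwise_kernel[OF t] by blast
  interpret F': functor_setting "opposite I" "opposite_ab C"
    by (rule functor_setting_opposite)
  have ft: "flip t \<in> Hom F' N M" using t by (simp add: flip_Hom_iff)
  have "\<exists>k. is_kernel (opposite_ab C) (Component (flip t) i) k" if "i \<in> Obj (opposite I)" for i
    using C.ex_cokernel[OF Component_Arr[OF t]] that by (simp add: is_kernel_opposite_iff)
  from F'.ex_pointwise_kernel[OF ft this] obtain K k where k: "k \<in> Hom F' K N"
    and "\<And>i. i \<in> Obj (opposite I) \<Longrightarrow> is_kernel (opposite_ab C) (Component (flip t) i) (Component k i)"
    by blast
  \<comment> \<open>Writing \<open>k\<close> as a double flip gives it the shape demanded by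
    \<open>is_kernel_flip_iff\<close>.\<close>
  then have "is_kernel F' (flip t) (flip (flip k))"
    using F'.pointwise_kernel[OF ft k] by simp
  moreover have "flip k \<in> Hom F N K" using k flip_Hom_iff[of "flip k"] by simp
  ultimately show "\<exists>c. is_cokernel F t c"
    using is_kernel_flip_iff[OF t] by blast
qed

text \<open>The components of \<open>c\<close> and \<open>k\<close> are a cokernel and a kernel in
  \<open>C\<close>, though not necessarily the chosen ones. The criterion for arbitrary
  representatives therefore applies to the same \<open>k\<close>, both globally and at each
  object.\<close>

theorem exact_at_middle_pointwise_iff:
  assumes f: "f \<in> Hom F L M" and g: "g \<in> Hom F M N"
  shows "exact_at_middle F f g \<longleftrightarrow>
    (\<forall>i \<in> Obj I. exact_at_middle C (Component f i) (Component g i))"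
proof -
  define c k where "c = coker_arr F f" "k = im_arr F f"
  have arr: "f \<in> Arr F" using f by (simp add: Hom_def)
  have coker: "is_cokernel F f c" and im: "is_kernel F c k"
    unfolding c_k_def using arr functor_category.coker_arr_is_cokernel
      functor_category.im_arr_is_kernel by auto
  obtain Q where c: "c \<in> Hom F M Q" using functor_category.is_cokernel_Hom[OF coker f] by blast
  obtain K where k: "k \<in> Hom F K M" using functor_category.is_kernel_Hom[OF im c] by blast
  have coker_i: "\<forall>i \<in> Obj I. is_cokernel C (Component f i) (Component c i)"
    using is_cokernel_pointwise_iff[OF f c C.ex_cokernel[OF Component_Arr[OF f]]] coker by blast
  have im_i: "\<forall>i \<in> Obj I. is_kernel C (Component c i) (Component k i)"
    using is_kernel_pointwise_iff[OF c k C.ex_kernel[OF Component_Arr[OF c]]] im by blast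
  have "exact_at_middle F f g \<longleftrightarrow> is_kernel F g k"
    using functor_category.exact_at_middle_iff_kernel[OF f g coker im] .
  also have "\<dots> \<longleftrightarrow> (\<forall>i \<in> Obj I. is_kernel C (Component g i) (Component k i))"
    using is_kernel_pointwise_iff[OF g k C.ex_kernel[OF Component_Arr[OF g]]] by blast
  also have "\<dots> \<longleftrightarrow> (\<forall>i \<in> Obj I. exact_at_middle C (Component f i) (Component g i))"
    using C.exact_at_middle_iff_kernel[OF Component_Hom[OF f] Component_Hom[OF g]] coker_i im_i
    by blast
  finally show ?thesis .
qed

end

lemma (in abelian_category) kernel_cokernel_category: "kernel_cokernel_category C"
  using ex_kernel ex_cokernel by unfold_locales

text \<open>The link between exactness and the canonical map is used once for functors and once at
  each object; pointwise exactness connects the two levels.\<close>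

theorem lemma1p9:
  fixes C :: "('o, 'm) ab_category" and I :: "('i, 'j) category"
    and L M N :: "('i, 'j, 'o, 'm) functor_data"
    and f g :: "('i, 'j, 'o, 'm) transformation"
  assumes "abelian_category C" and "category I"
    and "f \<in> Hom (functor_category I C) L M"
    and "g \<in> Hom (functor_category I C) M N"
    and "g \<odot>\<^bsub>functor_category I C\<^esub> f = Zero (functor_category I C) L N"
  shows "(exact_at_middle (functor_category I C) f g \<longleftrightarrow>
            is_isomorphism (functor_category I C) (im_to_ker (functor_category I C) f g))
       \<and> (is_isomorphism (functor_category I C) (im_to_ker (functor_category I C) f g) \<longleftrightarrow>
            (\<forall>i \<in> Obj I. is_isomorphism C (im_to_ker C (Component f i) (Component g i))))
       \<and> ((\<forall>i \<in> Obj I. is_isomorphism C (im_to_ker C (Component f i) (Component g i))) \<longleftrightarrow>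
            (\<forall>i \<in> Obj I. exact_at_middle C (Component f i) (Component g i)))"
proof -
  interpret kernel_cokernel_functor_setting I C
    using assms(1,2) abelian_category.kernel_cokernel_category by (intro kernel_cokernel_functor_setting.intro)
  note f = assms(3) and g = assms(4)
  \<comment> \<open>Evaluating the vanishing composite at \<open>i\<close> is what makes the
    canonical map in \<open>C\<close> meaningful.\<close>
  have "Component g i \<odot>\<^bsub>C\<^esub> Component f i = Zero C (FObj L i) (FObj N i)" if "i \<in> Obj I" for i
    using arg_cong[OF assms(5), of "\<lambda>x. Component x i"] that
    by (simp add: Component_Comp Component_Zero)
  then have "\<forall>i \<in> Obj I. exact_at_middle C (Component f i) (Component g i) \<longleftrightarrow>
      is_isomorphism C (im_to_ker C (Component f i) (Component g i))"
    using C.exact_at_middle_iff_im_to_ker[OF Component_Hom[OF f] Component_Hom[OF g]] by blast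
  then show ?thesis
    using functor_category.exact_at_middle_iff_im_to_ker[OF f g assms(5)]
      exact_at_middle_pointwise_iff[OF f g] by blast
qed

end
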